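(* Let $\Gamma$ be a game of the extensive form with unawareness, let $T \in \mathbf{T}$, and let $i \in I$ be a player. If player $i$ has perfect recall, i.e. whenever $i$ is active at two distinct nodes $n_1, n_k$ and there is a path $n_1, n_2, \dots, n_k$ along which $i$ takes action $a_i$ at $n_1$, then for every $n' \in h_i(n_k)$ there are a node $n'_1 \neq n'$ and a path $n'_1, \dots, n'_\ell = n'$ such that $h_i(n'_1) = h_i(n_1)$ and $i$ takes action $a_i$ at $n'_1$ along it, then for every $T$-partial mixed strategy of player $i$ there exists an equivalent $T$-partial behavior strategy of player $i$.
   Context: **Base tree.** $I$ is a finite set of players, $0$ denotes nature (possibly absent), and $I^0$ is the set of players including nature. $\bar T$ is a finite rooted directed tree with node set $\bar N = \bar D \cup \bar Z$ (disjoint; $\bar D \neq \emptyset$ decision nodes, $\bar Z$ terminal nodes) and precedence relation $\bar\lessdot$. Each $n \in \bar D$ has a nonempty set $P(n) \subseteq I^0$ of active players, each $i \in P(n)$ has a nonempty finite action set $A_i(n)$, and there is a bijection $\psi_n$ from $\prod_{i \in P(n)} A_i(n)$ onto the immediate successors of $n$. Terminal nodes have no successors and carry payoffs $(u_i(z))_{i\in I}$. **Forest.** A subtree $T$ of $\bar T$ is given by a set of nodes $N \subseteq \bar N$ with $N \cap \bar D \neq \emptyset$ such that $N$ with the restricted precedence relation is a tree. Write $T' \preceq T''$ if the nodes of $T'$ are a subset of the nodes of $T''$. $\mathbf{T}$ is a finite join-semilattice (under $\preceq$) of subtrees of $\bar T$, with top element $\bar T \in \mathbf{T}$, such that: (0)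 if $n \,\bar\lessdot\, n' \,\bar\lessdot\, n''$ and $n, n''$ are in $T \in \mathbf{T}$, then $n'$ is in $T$; (1) all terminal nodes of each $T \in \mathbf{T}$ are in $\bar Z$; (2) for every $T \in \mathbf{T}$, decision node $n \in T$ and $i \in P(n)$ there is a nonempty $A_i^T(n) \subseteq A_i(n)$ such that $\psi_n$ maps $\prod_{i \in P(n)} A_i^T(n)$ bijectively onto the immediate successors of $n$ in $T$; (3) for any $T\in\mathbf{T}$ and decision nodes $n,n' \in T$ with $i \in P(n)\cap P(n')$, if $A_i(n) \cap A_i(n') \neq \emptyset$ then $A_i(n) = A_i(n')$. Appearances of the same node in different trees are treated as distinct objects: $n_T$ is the copy in $T$ of a node $n$ (if it exists in $T$), copies commute ($(n_{T'})_T = n_T$), and $n_T = n$ if $n \in T$. $\mathbf{N}$ and $\mathbf{D}$ are the disjoint unions over $T \in \mathbf{T}$ of all nodes and of all decision nodes; $\mathbf{D}_i$ is the set of nodes in $\mathbf{D}$ at which $i$ is active; $T_n$ is the tree containing $n \in \mathbf{N}$. For a node $n$ of a tree $T$, $A_i(n)$ denotes the actions available at $n$ in $T$, i.e. $A_i^T(n)$. Paths are directed paths within one tree. **Information sets.** For each $n \in \mathbf{D}$ and $i \in P(n)\setminus\{0\}$ there is a nonempty information set $h_i(n) \subseteq \mathbf{D}_i$ such that: (I2) if $n' \in h_i(n)$ then $h_i(n') = h_i(n)$; (I3) if $n' \in h_i(n) \subseteq T'$ and there is a path $n',\dots,n''$ in $T'$ with $i \in P(n') \cap P(n'')$, then $h_i(n'')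 \subseteq T'$; (I4) if $n' \in h_i(n)$ then $A_i(n') \subseteq A_i(n)$; (I5) for $T \in \mathbf{T}$ and decision nodes $n,n' \in T$, if $A_i(n) = A_i(n')$ then $h_i(n') = h_i(n)$; (U0) if $n \in T$ and $i \in P(n)$, there is $T' \in \mathbf{T}$, $T' \preceq T$, with $h_i(n) \subseteq T'$; (U1) if $n \in T$ and $h_i(n) \subseteq T'$, then the copy $n_{T'}$ exists and $n_{T'} \in h_i(n)$; (U4) if $T \preceq T' \preceq T''$, $n \in T''$, $h_i(n) \subseteq T$ and $T'$ contains the copy $n_{T'}$, then $h_i(n_{T'}) = h_i(n)$; (U5) if $T \preceq T' \preceq T''$, $n \in T''$, $h_i(n) \subseteq T'$ and $T$ contains the copy $n_T$, then $h_i(n_T)$ consists of the copies that exist in $T$ of the nodes of $h_i(n)$. These data form a *game of the extensive form with unawareness* $\Gamma$. All nodes in an information set $h_i$ have the same action set for $i$, written $A_i(h_i)$. **Perfect recall (I6) for player $i$:** if $i$ is active at two distinct nodes $n_1, n_k$ and there is a path $n_1, n_2, \dots, n_k$ along which $i$ takes action $a_i$ at $n_1$, then for every $n' \in h_i(n_k)$ there are a node $n'_1 \neq n'$ and a path $n'_1, \dots, n'_\ell = n'$ such that $h_i(n'_1) = h_i(n_1)$ and $i$ takes action $a_i$ at $n'_1$ along it. **$T$-partial game.** For $T', T'' \in \mathbf{T}$ write $T' \rightarrowtail T''$ if $h_j(n) \subseteq T''$ for some node $n \in T'$ and some $j \in P(n)\setminus\{0\}$; $\hookrightarrow$ is the transitive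 closure of $\rightarrowtail$. The *$T$-partial game* consists of $T$ and all trees $T' \in \mathbf{T}$ with $T \hookrightarrow T'$ (its most expressive tree is $T$), with information sets as in $\Gamma$. $H_i^T$ is the set of player $i$'s information sets in the $T$-partial game, i.e. those contained in $T$ or in some $T'$ with $T \hookrightarrow T'$. **$T$-partial strategies.** $T$-partial pure strategies: $S_i^T = \prod_{h_i \in H_i^T} A_i(h_i)$ for $i \in I$, and for nature $S_0^T$ is the product of $A_0(n)$ over nature's nodes $n$ in trees of the $T$-partial game; $S_{-i}^T = \prod_{j \in I^0 \setminus\{i\}} S_j^T$. Under $s_i \in S_i^T$, player $i\in I$ plays $s_i(h_i(n))$ at every node $n$ of the $T$-partial game where $i$ is active; nature plays $s_0(n)$. $T$-partial mixed strategies: $\sigma_i \in \Delta(S_i^T)$. $T$-partial behavior strategies: $\beta_i \in \prod_{h_i \in H_i^T} \Delta(A_i(h_i))$; the mixed action at a node $n$ where $i$ is active is $\beta_i(h_i(n))$ (actions outside $A_i(h_i(n))$ get probability $0$), with independent randomization across nodes. **Reaching and equivalence.** A $T$-partial pure profile $s$ reaches a node $n$ of a tree $T'$ of the $T$-partial game if $n$ lies on the path in $T'$ that starts at the root of $T'$ and follows the actions prescribed by $s$. $\rho(n \mid \sigma_i, s_{-i})$ is the $\sigma_i$-probability of the set of $s_i$ such that $(s_i, s_{-i})$ reaches $n$. $\rho(n \mid \beta_i, s_{-i})$ is the probability that $(\beta_i, s_{-i})$ reaches $n$: it is $0$ if at some node strictly preceding $n$ in $T_n$ the action prescribed by $s_{-i}$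 for some active player other than $i$ is not the one leading towards $n$, and otherwise is the product, over the nodes $n' \in \mathbf{D}_i$ strictly preceding $n$ in $T_n$, of $\beta_i(h_i(n'))(a)$, where $a$ is $i$'s action at $n'$ leading towards $n$. $\sigma_i$ and $\beta_i$ are *equivalent* if $\rho(n \mid \sigma_i, s_{-i}) = \rho(n \mid \beta_i, s_{-i})$ for all $s_{-i} \in S_{-i}^T$ and all nodes $n$ of the trees of the $T$-partial game. *)

theory Defs
  imports "HOL-Probability.Probability_Mass_Function"
begin

text \<open>
  A tree is given by its node set and the strict precedence relation. Players other than nature
  have type \<open>'p\<close>; the set of all players including nature lives in \<open>'p option\<close>, with \<open>None\<close> for
  nature. A game without nature is one in which \<open>None\<close> is never active.
\<close>

definition is_tree :: "('v \<Rightarrow> 'v \<Rightarrow> bool) \<Rightarrow> 'v set \<Rightarrow> bool" where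
  "is_tree prc N \<longleftrightarrow>
     finite N \<and> irreflp_on N prc \<and> transp_on N prc \<and>
     (\<exists>r\<in>N. \<forall>n\<in>N. n \<noteq> r \<longrightarrow> prc r n) \<and>
     (\<forall>n\<in>N. totalp_on {m \<in> N. prc m n} prc)"

definition tree_root :: "('v \<Rightarrow> 'v \<Rightarrow> bool) \<Rightarrow> 'v set \<Rightarrow> 'v" where
  "tree_root prc N = (THE r. r \<in> N \<and> (\<forall>n\<in>N. n \<noteq> r \<longrightarrow> prc r n))"

definition imm_succs :: "('v \<Rightarrow> 'v \<Rightarrow> bool) \<Rightarrow> 'v set \<Rightarrow> 'v \<Rightarrow> 'v set" where
  "imm_succs prc N n = {m \<in> N. prc n m \<and> \<not> (\<exists>k\<in>N. prc n k \<and> prc k m)}"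

text \<open>
  A subtree of the base tree is identified with its set of nodes. The copy in \<open>T\<close> of a node \<open>n\<close>
  is the pair \<open>(T, n)\<close>; it exists iff \<open>n \<in> T\<close>.
\<close>

type_synonym 'v copy = "'v set \<times> 'v"

text \<open>
  \<open>acts_in G T n k\<close> is the set of actions of \<open>k\<close> at \<open>n\<close> in the subtree \<open>T\<close>. The axioms
  \<open>acts_in_sub\<close> and \<open>acts_in_bij\<close> below determine it at the decision nodes of each tree, because
  \<open>move G n\<close> is injective on action profiles and the action sets are nonempty.
\<close>

record ('p, 'v, 'a) ef_game =
  players :: "'p set"
  dec :: "'v set"
  ter :: "'v set"
  prec :: "'v \<Rightarrow> 'v \<Rightarrow> bool"
  active :: "'v \<Rightarrow> 'p option set"
  acts :: "'v \<Rightarrow> 'p option \<Rightarrow> 'a set"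
  move :: "'v \<Rightarrow> ('p option \<Rightarrow> 'a) \<Rightarrow> 'v"
  payoff :: "'p \<Rightarrow> 'v \<Rightarrow> real"
  trees :: "'v set set"
  acts_in :: "'v set \<Rightarrow> 'v \<Rightarrow> 'p option \<Rightarrow> 'a set"
  info :: "'p \<Rightarrow> 'v copy \<Rightarrow> 'v copy set"

definition base_nodes :: "('p, 'v, 'a) ef_game \<Rightarrow> 'v set" where
  "base_nodes G = dec G \<union> ter G"

definition copies :: "'v set \<Rightarrow> 'v copy set" where
  "copies T = {T} \<times> T"

definition all_copies :: "('p, 'v, 'a) ef_game \<Rightarrow> 'v copy set" where
  "all_copies G = (\<Union>T\<in>trees G. copies T)"

definition active_copies :: "('p, 'v, 'a) ef_game \<Rightarrow> 'p option \<Rightarrow> 'v copy set" where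
  "active_copies G k = {(T, n) \<in> all_copies G. n \<in> dec G \<and> k \<in> active G n}"

definition avail :: "('p, 'v, 'a) ef_game \<Rightarrow> 'v copy \<Rightarrow> 'p option \<Rightarrow> 'a set" where
  "avail G x k = acts_in G (fst x) (snd x) k"

definition is_path :: "('p, 'v, 'a) ef_game \<Rightarrow> 'v copy list \<Rightarrow> bool" where
  "is_path G xs \<longleftrightarrow>
     xs \<noteq> [] \<and> set xs \<subseteq> all_copies G \<and>
     successively (\<lambda>x y. fst y = fst x \<and> snd y \<in> imm_succs (prec G) (fst x) (snd x)) xs"

locale base_tree =
  fixes G :: "('p, 'v, 'a) ef_game"
  assumes finite_players: "finite (players G)"
    and dec_ter_disjoint: "dec G \<inter> ter G = {}"
    and dec_nonempty: "dec G \<noteq> {}"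
    and base_is_tree: "is_tree (prec G) (base_nodes G)"
    and ter_no_succ: "\<lbrakk>z \<in> ter G; n \<in> base_nodes G\<rbrakk> \<Longrightarrow> \<not> prec G z n"
    and active_nonempty: "n \<in> dec G \<Longrightarrow> active G n \<noteq> {}"
    and active_players: "n \<in> dec G \<Longrightarrow> active G n \<subseteq> insert None (Some ` players G)"
    and acts_nonempty: "\<lbrakk>n \<in> dec G; k \<in> active G n\<rbrakk> \<Longrightarrow> acts G n k \<noteq> {}"
    and acts_finite: "\<lbrakk>n \<in> dec G; k \<in> active G n\<rbrakk> \<Longrightarrow> finite (acts G n k)"
    and move_bij: "n \<in> dec G \<Longrightarrow>
      bij_betw (move G n) (\<Pi>\<^sub>E k\<in>active G n. acts G n k) (imm_succs (prec G) (base_nodes G) n)"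

locale forest = base_tree +
  assumes trees_sub: "T \<in> trees G \<Longrightarrow> T \<subseteq> base_nodes G"
    and trees_dec: "T \<in> trees G \<Longrightarrow> T \<inter> dec G \<noteq> {}"
    and trees_tree: "T \<in> trees G \<Longrightarrow> is_tree (prec G) T"
    and trees_top: "base_nodes G \<in> trees G"
    and trees_join: "\<lbrakk>T \<in> trees G; T' \<in> trees G\<rbrakk> \<Longrightarrow>
      \<exists>J\<in>trees G. T \<subseteq> J \<and> T' \<subseteq> J \<and> (\<forall>K\<in>trees G. T \<subseteq> K \<and> T' \<subseteq> K \<longrightarrow> J \<subseteq> K)"
    and trees_convex: "\<lbrakk>T \<in> trees G; n \<in> T; n' \<in> base_nodes G; n'' \<in> T;
      prec G n n'; prec G n' n''\<rbrakk> \<Longrightarrow> n' \<in> T"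
    and trees_ter: "\<lbrakk>T \<in> trees G; n \<in> T; \<And>m. m \<in> T \<Longrightarrow> \<not> prec G n m\<rbrakk> \<Longrightarrow> n \<in> ter G"
    and acts_in_nonempty: "\<lbrakk>T \<in> trees G; n \<in> T \<inter> dec G; k \<in> active G n\<rbrakk> \<Longrightarrow>
      acts_in G T n k \<noteq> {}"
    and acts_in_sub: "\<lbrakk>T \<in> trees G; n \<in> T \<inter> dec G; k \<in> active G n\<rbrakk> \<Longrightarrow>
      acts_in G T n k \<subseteq> acts G n k"
    and acts_in_bij: "\<lbrakk>T \<in> trees G; n \<in> T \<inter> dec G\<rbrakk> \<Longrightarrow>
      bij_betw (move G n) (\<Pi>\<^sub>E k\<in>active G n. acts_in G T n k) (imm_succs (prec G) T n)"
    and acts_in_partition: "\<lbrakk>T \<in> trees G; n \<in> T \<inter> dec G; n' \<in> T \<inter> dec G;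
      k \<in> active G n \<inter> active G n'; acts_in G T n k \<inter> acts_in G T n' k \<noteq> {}\<rbrakk> \<Longrightarrow>
      acts_in G T n k = acts_in G T n' k"

text \<open>
  \<open>info G i x \<subseteq> copies T\<close> says that the information set of \<open>i\<close> at \<open>x\<close> consists of nodes of \<open>T\<close>.
\<close>

locale unawareness_game = forest +
  assumes info_nonempty: "x \<in> active_copies G (Some i) \<Longrightarrow> info G i x \<noteq> {}"
    and info_sub: "x \<in> active_copies G (Some i) \<Longrightarrow> info G i x \<subseteq> active_copies G (Some i)"
    and I2: "\<lbrakk>x \<in> active_copies G (Some i); y \<in> info G i x\<rbrakk> \<Longrightarrow> info G i y = info G i x"
    and I3: "\<lbrakk>x \<in> active_copies G (Some i); y \<in> info G i x; T \<in> trees G; info G i x \<subseteq> copies T;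
      is_path G xs; hd xs = y; last xs = z; z \<in> copies T; z \<in> active_copies G (Some i)\<rbrakk> \<Longrightarrow>
      info G i z \<subseteq> copies T"
    and I4: "\<lbrakk>x \<in> active_copies G (Some i); y \<in> info G i x\<rbrakk> \<Longrightarrow>
      avail G y (Some i) \<subseteq> avail G x (Some i)"
    and I5: "\<lbrakk>(T, n) \<in> active_copies G (Some i); (T, n') \<in> active_copies G (Some i);
      avail G (T, n) (Some i) = avail G (T, n') (Some i)\<rbrakk> \<Longrightarrow> info G i (T, n') = info G i (T, n)"
    and U0: "(T, n) \<in> active_copies G (Some i) \<Longrightarrow>
      \<exists>T'\<in>trees G. T' \<subseteq> T \<and> info G i (T, n) \<subseteq> copies T'"
    and U1: "\<lbrakk>(T, n) \<in> active_copies G (Some i); T' \<in> trees G; info G i (T, n) \<subseteq> copies T'\<rbrakk> \<Longrightarrow>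
      n \<in> T' \<and> (T', n) \<in> info G i (T, n)"
    and U4: "\<lbrakk>T \<in> trees G; T' \<in> trees G; T \<subseteq> T'; T' \<subseteq> T''; (T'', n) \<in> active_copies G (Some i);
      info G i (T'', n) \<subseteq> copies T; n \<in> T'\<rbrakk> \<Longrightarrow> info G i (T', n) = info G i (T'', n)"
    and U5: "\<lbrakk>T \<in> trees G; T' \<in> trees G; T \<subseteq> T'; T' \<subseteq> T''; (T'', n) \<in> active_copies G (Some i);
      info G i (T'', n) \<subseteq> copies T'; n \<in> T\<rbrakk> \<Longrightarrow>
      info G i (T, n) = {(T, m) |m. (T', m) \<in> info G i (T'', n) \<and> m \<in> T}"

text \<open>
  Player \<open>k\<close> takes action \<open>a\<close> at the first node of a path \<open>xs\<close> of at least two nodes.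
\<close>

definition takes_first :: "('p, 'v, 'a) ef_game \<Rightarrow> 'p option \<Rightarrow> 'a \<Rightarrow> 'v copy list \<Rightarrow> bool" where
  "takes_first G k a xs \<longleftrightarrow> 2 \<le> length xs \<and>
     (\<exists>f \<in> (\<Pi>\<^sub>E j\<in>active G (snd (xs ! 0)). avail G (xs ! 0) j).
        f k = a \<and> move G (snd (xs ! 0)) f = snd (xs ! 1))"

definition perfect_recall :: "('p, 'v, 'a) ef_game \<Rightarrow> 'p \<Rightarrow> bool" where
  "perfect_recall G i \<longleftrightarrow>
     (\<forall>xs a. is_path G xs \<and> hd xs \<noteq> last xs \<and>
        hd xs \<in> active_copies G (Some i) \<and> last xs \<in> active_copies G (Some i) \<and>
        takes_first G (Some i) a xs \<longrightarrow>
        (\<forall>y \<in> info G i (last xs). \<exists>ys. is_path G ys \<and> last ys = y \<and> hd ys \<noteq> y \<and>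
           hd ys \<in> active_copies G (Some i) \<and> info G i (hd ys) = info G i (hd xs) \<and>
           takes_first G (Some i) a ys))"

definition leads :: "('p, 'v, 'a) ef_game \<Rightarrow> ('v set \<times> 'v set) set" where
  "leads G = {(T', T''). T' \<in> trees G \<and> T'' \<in> trees G \<and>
     (\<exists>n j. (T', n) \<in> active_copies G (Some j) \<and> info G j (T', n) \<subseteq> copies T'')}"

definition partial_trees :: "('p, 'v, 'a) ef_game \<Rightarrow> 'v set \<Rightarrow> 'v set set" where
  "partial_trees G T = insert T {T'. (T, T') \<in> (leads G)\<^sup>+}"

definition partial_infos :: "('p, 'v, 'a) ef_game \<Rightarrow> 'v set \<Rightarrow> 'p \<Rightarrow> 'v copy set set" where
  "partial_infos G T i =
     {H. (\<exists>x \<in> active_copies G (Some i). H = info G i x) \<and>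
         (\<exists>T' \<in> partial_trees G T. H \<subseteq> copies T')}"

text \<open>
  All nodes of an information set have the same available actions (by \<open>I2\<close> and \<open>I4\<close>), so the
  choice of the node is immaterial.
\<close>

definition info_acts :: "('p, 'v, 'a) ef_game \<Rightarrow> 'p \<Rightarrow> 'v copy set \<Rightarrow> 'a set" where
  "info_acts G i H = avail G (SOME x. x \<in> H) (Some i)"

type_synonym ('v, 'a) pure = "'v copy set \<Rightarrow> 'a"

definition pure_strats :: "('p, 'v, 'a) ef_game \<Rightarrow> 'v set \<Rightarrow> 'p \<Rightarrow> ('v, 'a) pure set" where
  "pure_strats G T i = (\<Pi>\<^sub>E H\<in>partial_infos G T i. info_acts G i H)"

definition nature_strats :: "('p, 'v, 'a) ef_game \<Rightarrow> 'v set \<Rightarrow> ('v copy \<Rightarrow> 'a) set" where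
  "nature_strats G T =
     (\<Pi>\<^sub>E x\<in>{x \<in> active_copies G None. fst x \<in> partial_trees G T}. avail G x None)"

text \<open>
  A pure profile pairs the strategies of the players with that of nature, whose strategies are
  indexed by nodes rather than information sets.
\<close>

type_synonym ('p, 'v, 'a) profile = "('p \<Rightarrow> ('v, 'a) pure) \<times> ('v copy \<Rightarrow> 'a)"

definition opp_profiles ::
    "('p, 'v, 'a) ef_game \<Rightarrow> 'v set \<Rightarrow> 'p \<Rightarrow> ('p, 'v, 'a) profile set" where
  "opp_profiles G T i =
     (\<Pi>\<^sub>E j\<in>players G - {i}. pure_strats G T j) \<times> nature_strats G T"

definition combine ::
    "'p \<Rightarrow> ('v, 'a) pure \<Rightarrow> ('p, 'v, 'a) profile \<Rightarrow> ('p, 'v, 'a) profile" where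
  "combine i s t = ((fst t)(i := s), snd t)"

definition mixed_strats :: "('p, 'v, 'a) ef_game \<Rightarrow> 'v set \<Rightarrow> 'p \<Rightarrow> ('v, 'a) pure pmf set" where
  "mixed_strats G T i = {\<sigma>. set_pmf \<sigma> \<subseteq> pure_strats G T i}"

definition behavior_strats ::
    "('p, 'v, 'a) ef_game \<Rightarrow> 'v set \<Rightarrow> 'p \<Rightarrow> ('v copy set \<Rightarrow> 'a pmf) set" where
  "behavior_strats G T i =
     (\<Pi>\<^sub>E H\<in>partial_infos G T i. {p. set_pmf p \<subseteq> info_acts G i H})"

fun prescribed ::
    "('p, 'v, 'a) ef_game \<Rightarrow> ('p, 'v, 'a) profile \<Rightarrow> 'v copy \<Rightarrow> 'p option \<Rightarrow> 'a" where
  "prescribed G s x None = snd s x"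
| "prescribed G s x (Some j) = fst s j (info G j x)"

inductive reaches ::
    "('p, 'v, 'a) ef_game \<Rightarrow> 'v set \<Rightarrow> ('p, 'v, 'a) profile \<Rightarrow> 'v \<Rightarrow> bool"
  for G T s where
  root: "reaches G T s (tree_root (prec G) T)"
| step: "reaches G T s n \<Longrightarrow> n \<in> T \<inter> dec G \<Longrightarrow>
    reaches G T s (move G n (\<lambda>k\<in>active G n. prescribed G s (T, n) k))"

text \<open>The action of \<open>k\<close> at the node \<open>m\<close> of \<open>T\<close> that leads towards the later node \<open>n\<close>.\<close>

definition action_towards ::
    "('p, 'v, 'a) ef_game \<Rightarrow> 'v set \<Rightarrow> 'v \<Rightarrow> 'v \<Rightarrow> 'p option \<Rightarrow> 'a" where
  "action_towards G T m n k =
     (THE a. \<exists>f \<in> (\<Pi>\<^sub>E j\<in>active G m. acts_in G T m j).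
        f k = a \<and> (move G m f = n \<or> prec G (move G m f) n))"

definition rho_mixed :: "('p, 'v, 'a) ef_game \<Rightarrow> 'v set \<Rightarrow> 'p \<Rightarrow> 'v copy \<Rightarrow>
    ('v, 'a) pure pmf \<Rightarrow> ('p, 'v, 'a) profile \<Rightarrow> real" where
  "rho_mixed G T i x \<sigma> t =
     measure_pmf.prob \<sigma>
       {s \<in> pure_strats G T i. reaches G (fst x) (combine i s t) (snd x)}"

definition rho_behavior :: "('p, 'v, 'a) ef_game \<Rightarrow> 'p \<Rightarrow> 'v copy \<Rightarrow>
    ('v copy set \<Rightarrow> 'a pmf) \<Rightarrow> ('p, 'v, 'a) profile \<Rightarrow> real" where
  "rho_behavior G i x \<beta> t =
     (let T = fst x; n = snd x in
      if \<exists>m\<in>T. prec G m n \<and>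
           (\<exists>k \<in> active G m - {Some i}. prescribed G t (T, m) k \<noteq> action_towards G T m n k)
      then 0
      else \<Prod>m \<in> {m \<in> T. prec G m n \<and> Some i \<in> active G m}.
             pmf (\<beta> (info G i (T, m))) (action_towards G T m n (Some i)))"

definition equivalent_strats :: "('p, 'v, 'a) ef_game \<Rightarrow> 'v set \<Rightarrow> 'p \<Rightarrow>
    ('v, 'a) pure pmf \<Rightarrow> ('v copy set \<Rightarrow> 'a pmf) \<Rightarrow> bool" where
  "equivalent_strats G T i \<sigma> \<beta> \<longleftrightarrow>
     (\<forall>t \<in> opp_profiles G T i. \<forall>T' \<in> partial_trees G T. \<forall>x \<in> copies T'.
        rho_mixed G T i x \<sigma> t = rho_behavior G i x \<beta> t)"

end

theory Submission
  imports Defs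
begin

text \<open>
  As in Kuhn's theorem, record the experience of player \<open>i\<close> at a node \<open>n\<close>: the set of pairs of an
  information set met strictly before \<open>n\<close> and the action taken there. Under perfect recall all
  nodes with the same information set \<open>H\<close>, even in different trees, have the same experience. The
  behavior strategy draws at \<open>H\<close> from \<open>\<sigma>\<close> conditioned on the pure strategies that agree with this
  experience, and the reaching probability telescopes along the path to \<open>n\<close>.
\<close>

section \<open>Finite trees as strict orders with linearly ordered predecessors\<close>

lemma tree_minimal:
  assumes "is_tree prc N" "S \<subseteq> N" "S \<noteq> {}"
  obtains c where "c \<in> S" "\<And>d. d \<in> S \<Longrightarrow> \<not> prc d c"
proof -
  have "transp_on S prc" "irreflp_on S prc" "finite S"
    using assms unfolding is_tree_def
    by (auto intro: transp_on_subset irreflp_on_subset finite_subset)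
  then have "\<exists>m\<in>S. \<forall>x\<in>S. x \<noteq> m \<longrightarrow> \<not> prc x m"
    using Finite_Set.bex_min_element[of S prc] assms(3)
    by (metis asymp_on_iff_irreflp_on_if_transp_on)
  then show ?thesis
    using that \<open>irreflp_on S prc\<close> by (metis irreflp_onD)
qed

lemma tree_maximal:
  assumes "is_tree prc N" "S \<subseteq> N" "S \<noteq> {}"
  obtains c where "c \<in> S" "\<And>d. d \<in> S \<Longrightarrow> \<not> prc c d"
proof -
  have "transp_on S prc" "irreflp_on S prc" "finite S"
    using assms unfolding is_tree_def
    by (auto intro: transp_on_subset irreflp_on_subset finite_subset)
  then have "\<exists>m\<in>S. \<forall>x\<in>S. x \<noteq> m \<longrightarrow> \<not> prc m x"
    using Finite_Set.bex_max_element[of S prc] assms(3)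
    by (metis asymp_on_iff_irreflp_on_if_transp_on)
  then show ?thesis
    using that \<open>irreflp_on S prc\<close> by (metis irreflp_onD)
qed

lemma tree_trans:
  assumes "is_tree prc N" "a \<in> N" "b \<in> N" "c \<in> N" "prc a b" "prc b c"
  shows "prc a c"
  using assms unfolding is_tree_def by (meson transp_onD)

lemma tree_irrefl:
  assumes "is_tree prc N" "a \<in> N"
  shows "\<not> prc a a"
  using assms unfolding is_tree_def by (meson irreflp_onD)

lemma tree_preds_total:
  assumes "is_tree prc N" "n \<in> N" "a \<in> N" "b \<in> N" "prc a n" "prc b n" "a \<noteq> b"
  shows "prc a b \<or> prc b a"
  using assms unfolding is_tree_def totalp_on_def by blast

text \<open>A minimal node among those after \<open>m\<close> and at or before \<open>n\<close>
  works: a node between \<open>m\<close> and it would be a smaller candidate.\<close>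

lemma imm_succs_towards_exists:
  assumes tree: "is_tree prc N" and "m \<in> N" "n \<in> N" "prc m n"
  obtains c where "c \<in> imm_succs prc N m" "c = n \<or> prc c n"
proof -
  let ?S = "{c \<in> N. prc m c \<and> (c = n \<or> prc c n)}"
  obtain c where c: "c \<in> ?S" "\<And>d. d \<in> ?S \<Longrightarrow> \<not> prc d c"
    using tree_minimal[OF tree, of ?S] assms by blast
  have "c \<in> imm_succs prc N m"
    using c tree_trans[OF tree] \<open>n \<in> N\<close> unfolding imm_succs_def by blast
  then show ?thesis using that c(1) by blast
qed

text \<open>The predecessors of \<open>n\<close> form a chain, so two distinct candidates would be
  comparable, and then the earlier one would lie strictly between \<open>m\<close> and the later
  one.\<close>

lemma imm_succs_towards_unique:
  assumes tree: "is_tree prc N" and "n \<in> N"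
    and "c \<in> imm_succs prc N m" "c = n \<or> prc c n"
    and "d \<in> imm_succs prc N m" "d = n \<or> prc d n"
  shows "c = d"
proof -
  have cd: "c \<in> N" "d \<in> N" "\<not> prc c d" "\<not> prc d c"
    using assms(3,5) unfolding imm_succs_def by auto
  then show ?thesis
    using assms(4,6) tree_preds_total[OF tree \<open>n \<in> N\<close> cd(1,2)] by auto
qed

lemma tree_root_eq:
  assumes tree: "is_tree prc N" and "r \<in> N" "\<forall>n\<in>N. n \<noteq> r \<longrightarrow> prc r n"
  shows "tree_root prc N = r"
  unfolding tree_root_def
proof (rule the_equality)
  fix s assume s: "s \<in> N \<and> (\<forall>n\<in>N. n \<noteq> s \<longrightarrow> prc s n)"
  show "s = r"
  proof (rule ccontr)
    assume "s \<noteq> r"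
    then have "prc s r" "prc r s" using s assms by auto
    then show False
      using tree_trans[OF tree, of s r s] tree_irrefl[OF tree, of s] s \<open>r \<in> N\<close> by blast
  qed
qed (use assms in blast)

lemma tree_root_least:
  assumes tree: "is_tree prc N"
  shows "tree_root prc N \<in> N" "n \<in> N \<Longrightarrow> n \<noteq> tree_root prc N \<Longrightarrow> prc (tree_root prc N) n"
proof -
  obtain r where r: "r \<in> N" "\<forall>n\<in>N. n \<noteq> r \<longrightarrow> prc r n"
    using tree unfolding is_tree_def by blast
  then have "tree_root prc N = r" using tree_root_eq[OF tree] by blast
  with r show "tree_root prc N \<in> N" "n \<in> N \<Longrightarrow> n \<noteq> tree_root prc N \<Longrightarrow> prc (tree_root prc N) n"
    by auto
qed

lemma tree_induct [consumes 2, case_names less]: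
  assumes tree: "is_tree prc N" and "n \<in> N"
    and step: "\<And>n. n \<in> N \<Longrightarrow> (\<And>m. m \<in> N \<Longrightarrow> prc m n \<Longrightarrow> P m) \<Longrightarrow> P n"
  shows "P n"
proof (rule ccontr)
  assume "\<not> P n"
  then obtain c where "c \<in> {m \<in> N. \<not> P m}" "\<And>d. d \<in> {m \<in> N. \<not> P m} \<Longrightarrow> \<not> prc d c"
    using tree_minimal[OF tree, of "{m \<in> N. \<not> P m}"] \<open>n \<in> N\<close> by blast
  then show False using step[of c] by blast
qed

section \<open>The experience of a player at a node\<close>

definition own_preds :: "('p, 'v, 'a) ef_game \<Rightarrow> 'p \<Rightarrow> 'v copy \<Rightarrow> 'v set" where
  "own_preds G i x = {m \<in> fst x. prec G m (snd x) \<and> Some i \<in> active G m}"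

definition experience ::
    "('p, 'v, 'a) ef_game \<Rightarrow> 'p \<Rightarrow> 'v copy \<Rightarrow> ('v copy set \<times> 'a) set" where
  "experience G i x =
     (\<lambda>m. (info G i (fst x, m), action_towards G (fst x) m (snd x) (Some i))) ` own_preds G i x"

definition consistent :: "('v copy set \<times> 'a) set \<Rightarrow> ('v, 'a) pure set" where
  "consistent E = {s. \<forall>(H, a)\<in>E. s H = a}"

section \<open>Actions, paths and reaching within one tree of the forest\<close>

context forest
begin

lemma prec_dec:
  assumes "T \<in> trees G" "m \<in> T" "n \<in> T" "prec G m n"
  shows "m \<in> dec G"
  using assms trees_sub[of T] ter_no_succ[of m n] unfolding base_nodes_def by blast

text \<open>Only one immediate successor leads to \<open>n\<close>, and \<open>move G m\<close> is
  injective on the profiles of \<open>T\<close>, so \<open>f\<close> is the only profile leading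
  there. This resolves the \<open>THE\<close> for all players at once.\<close>

lemma action_towards_eq:
  assumes T: "T \<in> trees G" and m: "m \<in> T" "m \<in> dec G" and n: "n \<in> T"
    and f: "f \<in> (\<Pi>\<^sub>E j\<in>active G m. acts_in G T m j)"
    and to: "move G m f = n \<or> prec G (move G m f) n"
  shows "action_towards G T m n k = f k"
proof -
  note bij = acts_in_bij[OF T IntI[OF m]]
  have "g = f" if "g \<in> (\<Pi>\<^sub>E j\<in>active G m. acts_in G T m j)"
      "move G m g = n \<or> prec G (move G m g) n" for g
    using imm_succs_towards_unique[OF trees_tree[OF T] n, of "move G m f" m "move G m g"]
      bij that f to unfolding bij_betw_def inj_on_def by blast
  then show ?thesis
    unfolding action_towards_def using f to by (intro the_equality) blast+
qed

lemma profile_towards_exists: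
  assumes T: "T \<in> trees G" and "m \<in> T" "n \<in> T" "prec G m n"
  obtains f where "f \<in> (\<Pi>\<^sub>E j\<in>active G m. acts_in G T m j)"
    "move G m f \<in> imm_succs (prec G) T m"
    "move G m f = n \<or> prec G (move G m f) n" "\<And>k. action_towards G T m n k = f k"
proof -
  have m: "m \<in> dec G" using prec_dec assms by blast
  obtain c where c: "c \<in> imm_succs (prec G) T m" "c = n \<or> prec G c n"
    using imm_succs_towards_exists[OF trees_tree[OF T]] assms by metis
  obtain f where f: "f \<in> (\<Pi>\<^sub>E j\<in>active G m. acts_in G T m j)" "move G m f = c"
    using acts_in_bij[OF T IntI[OF \<open>m \<in> T\<close> m]] c(1) unfolding bij_betw_def
    by (metis (no_types, lifting) imageE)
  show ?thesis
    using that[OF f(1)] f c action_towards_eq[OF T \<open>m \<in> T\<close> m \<open>n \<in> T\<close> f(1)] by simp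
qed

text \<open>The immediate successor of \<open>l\<close> that leads to \<open>m\<close> also leads to
  any node after \<open>m\<close>.\<close>

lemma action_towards_mono:
  assumes T: "T \<in> trees G" and "l \<in> T" "m \<in> T" "n \<in> T" "prec G l m" "prec G m n"
  shows "action_towards G T l n k = action_towards G T l m k"
proof -
  obtain f where f: "f \<in> (\<Pi>\<^sub>E j\<in>active G l. acts_in G T l j)"
    "move G l f \<in> imm_succs (prec G) T l"
    "move G l f = m \<or> prec G (move G l f) m" "action_towards G T l m k = f k"
    using profile_towards_exists[OF T, of l m] assms by metis
  have "move G l f \<in> T" using f(2) unfolding imm_succs_def by blast
  then have "prec G (move G l f) n"
    using f(3) assms tree_trans[OF trees_tree[OF T]] by blast
  then show ?thesis
    using action_towards_eq[OF T \<open>l \<in> T\<close> _ \<open>n \<in> T\<close> f(1)] prec_dec assms f(4) by simp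
qed

text \<open>Induction along the order: a path to the last node \<open>l\<close> before
  \<open>n\<close> that is not before \<open>m\<close> is prolonged by \<open>n\<close>, an
  immediate successor of \<open>l\<close>.\<close>

lemma path_exists:
  assumes T: "T \<in> trees G" and "m \<in> T" and "n \<in> T" "m = n \<or> prec G m n"
  shows "\<exists>xs. is_path G xs \<and> hd xs = (T, m) \<and> last xs = (T, n)"
  using trees_tree[OF T] \<open>n \<in> T\<close> assms(4)
proof (induction n rule: tree_induct)
  case (less n)
  show ?case
  proof (cases "m = n")
    case True
    then show ?thesis
      using T less.hyps by (intro exI[of _ "[(T, n)]"])
        (auto simp: is_path_def all_copies_def copies_def)
  next
    case False
    let ?S = "{l \<in> T. (m = l \<or> prec G m l) \<and> prec G l n}"
    obtain l where l: "l \<in> ?S" "\<And>d. d \<in> ?S \<Longrightarrow> \<not> prec G l d"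
      using tree_maximal[OF trees_tree[OF T], of ?S] False less \<open>m \<in> T\<close> by blast
    then obtain xs where xs: "is_path G xs" "hd xs = (T, m)" "last xs = (T, l)"
      using less.IH[of l] by blast
    have "n \<in> imm_succs (prec G) T l"
      using l less.hyps tree_trans[OF trees_tree[OF T] \<open>m \<in> T\<close>, of l]
      unfolding imm_succs_def by blast
    then have "is_path G (xs @ [(T, n)])"
      using xs T less.hyps
      by (auto simp: is_path_def successively_append_iff all_copies_def copies_def)
    moreover have "hd (xs @ [(T, n)]) = (T, m)"
      using xs unfolding is_path_def by simp
    ultimately show ?thesis by (metis last_snoc)
  qed
qed

lemma path_prec:
  assumes "is_path G xs"
  shows "fst (hd xs) = fst (last xs) \<and>
    (snd (hd xs) = snd (last xs) \<or> prec G (snd (hd xs)) (snd (last xs)))"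
  using assms
proof (induction xs)
  case Nil
  then show ?case by (simp add: is_path_def)
next
  case (Cons x xs)
  show ?case
  proof (cases xs)
    case Nil
    then show ?thesis by simp
  next
    case (Cons y ys)
    then have p: "is_path G xs" and fx: "fst y = fst x"
      and sy: "snd y \<in> imm_succs (prec G) (fst x) (snd x)"
      using Cons.prems unfolding is_path_def by auto
    have in_tree: "fst z \<in> trees G \<and> snd z \<in> fst z" if "z \<in> set (x # xs)" for z
      using that Cons.prems unfolding is_path_def all_copies_def copies_def by fastforce
    have "last xs \<in> set (x # xs)" using Cons by auto
    with in_tree have "snd (last xs) \<in> fst (last xs)" "fst (last xs) \<in> trees G" by auto
    moreover have "snd x \<in> fst x" "snd y \<in> fst x" using in_tree[of x] in_tree[of y] Cons fx by auto
    moreover have "prec G (snd x) (snd y)" using sy unfolding imm_succs_def by blast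
    moreover have "fst x = fst (last xs) \<and>
        (snd y = snd (last xs) \<or> prec G (snd y) (snd (last xs)))"
      using Cons.IH[OF p] Cons fx by simp
    ultimately show ?thesis
      using tree_trans[OF trees_tree, of "fst x" "snd x" "snd y" "snd (last xs)"] Cons by auto
  qed
qed

text \<open>With \<open>path_towards_exists\<close>, its converse, this translates the paths in the
  definition of perfect recall into precedence and \<open>action_towards\<close>.\<close>

lemma takes_first_towards:
  assumes "is_path G xs" "takes_first G k a xs" "hd xs = (T, m)" "last xs = (T', n)"
  shows "T' = T \<and> T \<in> trees G \<and> m \<in> T \<and> n \<in> T \<and> prec G m n \<and> a = action_towards G T m n k"
proof -
  obtain y ys where xs: "xs = (T, m) # y # ys"
    using assms(2,3) unfolding takes_first_def by (cases xs; cases "tl xs") auto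
  have T: "T \<in> trees G" "m \<in> T" and n: "n \<in> T'" and y: "snd y \<in> fst y"
    and fy: "fst y = T" and sy: "snd y \<in> imm_succs (prec G) T m" and p: "is_path G (y # ys)"
  proof -
    have in_tree: "fst z \<in> trees G \<and> snd z \<in> fst z" if "z \<in> set xs" for z
      using that assms(1) unfolding is_path_def all_copies_def copies_def by fastforce
    show "T \<in> trees G" "m \<in> T" using in_tree[of "(T, m)"] xs by auto
    have "last xs \<in> set xs" using xs by (intro last_in_set) simp
    then show "n \<in> T'" using in_tree[of "(T', n)"] assms(4) by simp
    show "snd y \<in> fst y" using in_tree[of y] xs by auto
    show "fst y = T" "snd y \<in> imm_succs (prec G) T m" "is_path G (y # ys)"
      using assms(1) unfolding is_path_def xs by auto
  qed
  have *: "T' = T" "snd y = n \<or> prec G (snd y) n"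
    using path_prec[OF p] fy assms(4) xs by auto
  have my: "prec G m (snd y)" using sy unfolding imm_succs_def by blast
  have mn: "prec G m n"
    using * my tree_trans[OF trees_tree[OF T(1)] T(2), of "snd y" n] y fy n by auto
  obtain f where f: "f \<in> (\<Pi>\<^sub>E j\<in>active G m. acts_in G T m j)" "f k = a" "move G m f = snd y"
    using assms(2) unfolding takes_first_def xs avail_def by auto
  have "action_towards G T m n k = f k"
    using action_towards_eq[OF T prec_dec[OF T _ mn] _ f(1)] * n f(3) by simp
  then show ?thesis using f * T n mn by simp
qed

lemma path_towards_exists:
  assumes T: "T \<in> trees G" and "m \<in> T" "n \<in> T" "prec G m n"
  obtains xs where "is_path G xs" "hd xs = (T, m)" "last xs = (T, n)"
    "takes_first G k (action_towards G T m n k) xs"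
proof -
  obtain f where f: "f \<in> (\<Pi>\<^sub>E j\<in>active G m. acts_in G T m j)"
    "move G m f \<in> imm_succs (prec G) T m"
    "move G m f = n \<or> prec G (move G m f) n" "action_towards G T m n k = f k"
    using profile_towards_exists[OF assms] by metis
  have "move G m f \<in> T" using f(2) unfolding imm_succs_def by blast
  then obtain ys where ys: "is_path G ys" "hd ys = (T, move G m f)" "last ys = (T, n)"
    using path_exists[OF T _ \<open>n \<in> T\<close>] f(3) by blast
  obtain zs where zs: "ys = (T, move G m f) # zs"
    using ys unfolding is_path_def by (cases ys) auto
  have "is_path G ((T, m) # ys)"
    using ys T \<open>m \<in> T\<close> f(2) unfolding is_path_def zs
    by (auto simp: all_copies_def copies_def)
  moreover have "takes_first G k (action_towards G T m n k) ((T, m) # ys)"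
    using f unfolding takes_first_def zs avail_def by auto
  ultimately show ?thesis using that[of "(T, m) # ys"] ys zs by auto
qed

text \<open>Legality of the prescribed actions keeps each move inside \<open>T\<close>. Each step
  adds one predecessor, and \<open>action_towards_mono\<close> preserves what is known about the
  earlier ones.\<close>

lemma reaches_imp_towards:
  assumes T: "T \<in> trees G"
    and legal: "\<And>m k. m \<in> T \<inter> dec G \<Longrightarrow> k \<in> active G m \<Longrightarrow> prescribed G s (T, m) k \<in> acts_in G T m k"
    and "reaches G T s n"
  shows "n \<in> T \<and> (\<forall>m\<in>T. prec G m n \<longrightarrow>
    (\<forall>k\<in>active G m. prescribed G s (T, m) k = action_towards G T m n k))"
  using assms(3)
proof induction
  case root
  note tree = trees_tree[OF T]
  have "\<not> prec G m (tree_root (prec G) T)" if "m \<in> T" for m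
  proof
    assume m: "prec G m (tree_root (prec G) T)"
    then have "m \<noteq> tree_root (prec G) T" using tree_irrefl[OF tree that] by auto
    then have "prec G (tree_root (prec G) T) m" using tree_root_least(2)[OF tree that] by blast
    then show False
      using m tree_trans[OF tree that tree_root_least(1)[OF tree] that] tree_irrefl[OF tree that]
      by blast
  qed
  then show ?case using tree_root_least(1)[OF tree] by blast
next
  case (step n)
  note tree = trees_tree[OF T]
  let ?g = "\<lambda>k\<in>active G n. prescribed G s (T, n) k"
  let ?n' = "move G n ?g"
  have g: "?g \<in> (\<Pi>\<^sub>E j\<in>active G n. acts_in G T n j)"
    using legal step.hyps by auto
  have succ: "?n' \<in> imm_succs (prec G) T n"
    using acts_in_bij[OF T step.hyps(2)] g unfolding bij_betw_def by blast
  then have n': "?n' \<in> T" "prec G n ?n'" unfolding imm_succs_def by auto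
  have "prescribed G s (T, m) k = action_towards G T m ?n' k"
    if m: "m \<in> T" "prec G m ?n'" and k: "k \<in> active G m" for m k
  proof (cases "m = n")
    case True
    then show ?thesis
      using action_towards_eq[OF T _ _ n'(1) g, of k] step.hyps k by simp
  next
    \<comment> \<open>As a predecessor of \<open>?n'\<close>, \<open>m\<close> is comparable with
      \<open>n\<close>; it cannot come after \<open>n\<close>, because \<open>?n'\<close> is an
      immediate successor of \<open>n\<close>.\<close>
    case False
    then have "prec G m n"
      using tree_preds_total[OF tree n'(1) m(1) _ m(2) n'(2)] succ step.hyps m
      unfolding imm_succs_def by blast
    then show ?thesis
      using step.IH m k action_towards_mono[OF T m(1) _ n'(1) _ n'(2)] step.hyps by auto
  qed
  then show ?case using n'(1) by blast
qed

text \<open>By induction the last predecessor \<open>m\<close> of \<open>n\<close> is reached, and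
  the profile prescribed at \<open>m\<close> is the one whose move is \<open>n\<close>.\<close>

lemma towards_imp_reaches:
  assumes T: "T \<in> trees G" and "n \<in> T"
    and "\<And>m k. m \<in> T \<Longrightarrow> prec G m n \<Longrightarrow> k \<in> active G m \<Longrightarrow>
      prescribed G s (T, m) k = action_towards G T m n k"
  shows "reaches G T s n"
  using trees_tree[OF T] \<open>n \<in> T\<close> assms(3)
proof (induction n rule: tree_induct)
  case (less n)
  note tree = trees_tree[OF T]
  show ?case
  proof (cases "n = tree_root (prec G) T")
    case True
    then show ?thesis by (simp add: reaches.root)
  next
    case False
    let ?S = "{m \<in> T. prec G m n}"
    obtain m where m: "m \<in> ?S" "\<And>d. d \<in> ?S \<Longrightarrow> \<not> prec G m d"
      using tree_maximal[OF tree, of ?S] tree_root_least[OF tree] False less.hyps by blast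
    have "reaches G T s m"
      using less.IH[of m] m less.prems less.hyps action_towards_mono[OF T]
        tree_trans[OF tree] by (metis (no_types, lifting) mem_Collect_eq)
    moreover have dec: "m \<in> T \<inter> dec G" using prec_dec[OF T] m less.hyps by blast
    moreover obtain f where f: "f \<in> (\<Pi>\<^sub>E j\<in>active G m. acts_in G T m j)"
      "move G m f \<in> imm_succs (prec G) T m"
      "move G m f = n \<or> prec G (move G m f) n" "\<And>k. action_towards G T m n k = f k"
      using profile_towards_exists[OF T, of m n] m less.hyps by blast
    moreover have "move G m f = n"
      using f(2,3) m unfolding imm_succs_def by blast
    \<comment> \<open>Both functions are \<open>undefined\<close> off \<open>active G m\<close>, so
      agreement on the active players suffices.\<close>
    moreover have "(\<lambda>k\<in>active G m. prescribed G s (T, m) k) = f"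
      using f less.prems[of m] m by (auto simp: restrict_def PiE_def extensional_def fun_eq_iff)
    ultimately show ?thesis using reaches.step by metis
  qed
qed

end

section \<open>Information sets and experience under perfect recall\<close>

context unawareness_game
begin

lemma info_self: "x \<in> active_copies G (Some i) \<Longrightarrow> y \<in> info G i x \<Longrightarrow>
    y \<in> active_copies G (Some i) \<and> info G i y = info G i x"
  using info_sub I2 by blast

lemma info_acts_avail:
  assumes "x \<in> active_copies G (Some i)"
  shows "info_acts G i (info G i x) \<subseteq> avail G x (Some i)"
proof -
  have "(SOME y. y \<in> info G i x) \<in> info G i x"
    using info_nonempty[OF assms] by (simp add: some_in_eq)
  then show ?thesis using I4[OF assms] unfolding info_acts_def by blast
qed

lemma info_acts_nonempty:
  assumes "x \<in> active_copies G (Some i)"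
  shows "info_acts G i (info G i x) \<noteq> {}"
proof -
  have "(SOME y. y \<in> info G i x) \<in> info G i x"
    using info_nonempty[OF assms] by (simp add: some_in_eq)
  then have "(SOME y. y \<in> info G i x) \<in> active_copies G (Some i)"
    using info_sub[OF assms] by blast
  then show ?thesis
    using acts_in_nonempty unfolding info_acts_def avail_def active_copies_def all_copies_def copies_def
    by fastforce
qed

lemma partial_trees_sub: "T \<in> trees G \<Longrightarrow> T' \<in> partial_trees G T \<Longrightarrow> T' \<in> trees G"
  unfolding partial_trees_def leads_def by (auto elim: trancl.cases)

text \<open>By \<open>U0\<close> the information set lies in a single tree, and \<open>leads\<close>
  relates \<open>T'\<close> to that tree, so it stays in the partial game. Strategies are thus
  defined wherever play in \<open>T'\<close> consults them.\<close>

lemma info_in_partial: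
  assumes "T' \<in> partial_trees G T" "T \<in> trees G" "(T', n) \<in> active_copies G (Some j)"
  shows "info G j (T', n) \<in> partial_infos G T j"
proof -
  obtain T'' where T'': "T'' \<in> trees G" "info G j (T', n) \<subseteq> copies T''"
    using U0 assms(3) by blast
  then have "(T', T'') \<in> leads G"
    using assms partial_trees_sub unfolding leads_def by blast
  then have "T'' \<in> partial_trees G T"
    using assms(1) unfolding partial_trees_def by (auto intro: trancl_into_trancl)
  then show ?thesis using T'' assms(3) unfolding partial_infos_def by blast
qed

text \<open>Perfect recall is applied to the path from each own predecessor \<open>m\<close> to
  \<open>n\<close>: the path it supplies into \<open>y\<close> starts at a predecessor with the same
  information set and action.\<close>

lemma experience_subset:
  assumes pr: "perfect_recall G i" and x: "x \<in> active_copies G (Some i)" and y: "y \<in> info G i x"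
  shows "experience G i x \<subseteq> experience G i y"
proof
  fix e
  obtain T n where xTn: "x = (T, n)" by force
  then have T: "T \<in> trees G" "n \<in> T"
    using x unfolding active_copies_def all_copies_def copies_def by auto
  assume "e \<in> experience G i x"
  then obtain m where m: "m \<in> T" "prec G m n" "Some i \<in> active G m"
    and e: "e = (info G i (T, m), action_towards G T m n (Some i))"
    unfolding experience_def own_preds_def xTn by auto
  have mact: "(T, m) \<in> active_copies G (Some i)"
    using m T prec_dec[OF T(1) m(1) T(2) m(2)]
    unfolding active_copies_def all_copies_def copies_def by auto
  obtain xs where xs: "is_path G xs" "hd xs = (T, m)" "last xs = (T, n)"
    "takes_first G (Some i) (action_towards G T m n (Some i)) xs"
    using path_towards_exists[OF T(1) m(1) T(2) m(2)] by blast
  have "m \<noteq> n" using m tree_irrefl[OF trees_tree[OF T(1)]] by blast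
  then obtain ys where ys: "is_path G ys" "last ys = y"
    "hd ys \<in> active_copies G (Some i)" "info G i (hd ys) = info G i (T, m)"
    "takes_first G (Some i) (action_towards G T m n (Some i)) ys"
    using pr[unfolded perfect_recall_def, rule_format, of xs "action_towards G T m n (Some i)" y]
      xs mact x y xTn by auto
  obtain T' m' where hd: "hd ys = (T', m')" by force
  obtain T'' n' where yn: "y = (T'', n')" by force
  have "T'' = T'" "m' \<in> T'" "prec G m' n'"
    "action_towards G T m n (Some i) = action_towards G T' m' n' (Some i)"
    using takes_first_towards[OF ys(1,5) hd] ys(2) yn by auto
  moreover have "Some i \<in> active G m'"
    using ys(3) hd unfolding active_copies_def by auto
  ultimately show "e \<in> experience G i y"
    using e ys(4) hd unfolding experience_def own_preds_def yn by force
qed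

text \<open>
  If an information set were met twice on a path, perfect recall would give each of its nodes a
  predecessor with the same information set, which lies in the information set itself by \<open>U1\<close>.
\<close>

lemma no_absentmindedness:
  assumes pr: "perfect_recall G i" and n: "(T, n) \<in> active_copies G (Some i)"
    and m: "m \<in> own_preds G i (T, n)"
  shows "info G i (T, m) \<noteq> info G i (T, n)"
proof
  let ?H = "info G i (T, n)"
  assume eq: "info G i (T, m) = ?H"
  obtain T' where T': "T' \<in> trees G" "?H \<subseteq> copies T'" using U0 n by blast
  \<comment> \<open>Since \<open>m\<close> has information set \<open>?H\<close>, this pair belongs
    to the experience at \<open>n\<close>, and \<open>experience_subset\<close> passes it on to
    every node of \<open>?H\<close>.\<close>
  have met: "(?H, action_towards G T m n (Some i)) \<in> experience G i (T, n)"
    using imageI[OF m, of "\<lambda>m. (info G i (T, m), action_towards G T m n (Some i))"] eq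
    unfolding experience_def by simp
  have pred: "\<exists>l\<in>T'. prec G l k \<and> (T', l) \<in> ?H" if k: "(T', k) \<in> ?H" for k
  proof -
    have "(?H, action_towards G T m n (Some i)) \<in> experience G i (T', k)"
      using experience_subset[OF pr n k] met by blast
    then obtain l where l: "l \<in> T'" "prec G l k" "Some i \<in> active G l" "info G i (T', l) = ?H"
      unfolding experience_def own_preds_def by auto
    have "k \<in> T'" using k T' unfolding copies_def by auto
    then have "(T', l) \<in> active_copies G (Some i)"
      using l T' prec_dec unfolding active_copies_def all_copies_def copies_def by auto
    then show ?thesis using U1[of T' l i T'] l T' by auto
  qed
  \<comment> \<open>The descent given by \<open>pred\<close> cannot go on in a finite tree: a
    minimal node of \<open>?H\<close> refutes it.\<close>
  let ?S = "{k \<in> T'. (T', k) \<in> ?H}"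
  have "?S \<noteq> {}" using info_nonempty[OF n] T'(2) unfolding copies_def by auto
  then obtain k where "k \<in> ?S" "\<And>d. d \<in> ?S \<Longrightarrow> \<not> prec G d k"
    using tree_minimal[OF trees_tree[OF T'(1)], of ?S] by blast
  then show False using pred[of k] by blast
qed

text \<open>Own predecessors are pairwise comparable, so by \<open>no_absentmindedness\<close> they
  have distinct information sets and no two of their pairs coincide.\<close>

lemma card_experience:
  assumes pr: "perfect_recall G i" and n: "(T, n) \<in> active_copies G (Some i)"
  shows "card (experience G i (T, n)) = card (own_preds G i (T, n))"
proof -
  have T: "T \<in> trees G" "n \<in> T"
    using n unfolding active_copies_def all_copies_def copies_def by auto
  have ne: "info G i (T, l) \<noteq> info G i (T, m)"
    if "l \<in> own_preds G i (T, n)" "m \<in> own_preds G i (T, n)" "prec G l m" for l m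
  proof -
    have "(T, m) \<in> active_copies G (Some i)" "l \<in> own_preds G i (T, m)"
      using that T prec_dec[of T m n]
      unfolding own_preds_def active_copies_def all_copies_def copies_def by auto
    then show ?thesis using no_absentmindedness[OF pr] by blast
  qed
  have "inj_on (\<lambda>m. info G i (T, m)) (own_preds G i (T, n))"
  proof (rule inj_onI, rule ccontr)
    fix l m
    assume *: "l \<in> own_preds G i (T, n)" "m \<in> own_preds G i (T, n)"
      "info G i (T, l) = info G i (T, m)" "l \<noteq> m"
    then have "prec G l m \<or> prec G m l"
      using tree_preds_total[OF trees_tree[OF T(1)] T(2)] unfolding own_preds_def by auto
    then show False using ne * by metis
  qed
  then show ?thesis
    unfolding experience_def by (intro card_image) (auto simp: inj_on_def)
qed

text \<open>
  The information set at \<open>(T, n)\<close> contains a copy \<open>(T', n)\<close> in a smaller tree. Perfect recall gives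
  one inclusion between the two experiences; since \<open>n\<close> has at most as many predecessors in \<open>T'\<close> as
  in \<open>T\<close>, counting turns it into an equality.
\<close>

lemma experience_info:
  assumes pr: "perfect_recall G i" and x: "x \<in> active_copies G (Some i)" and y: "y \<in> info G i x"
  shows "experience G i x = experience G i y"
proof -
  obtain T n where xTn: "x = (T, n)" by force
  then have T: "T \<in> trees G" "n \<in> T"
    using x unfolding active_copies_def all_copies_def copies_def by auto
  obtain T' where T': "T' \<in> trees G" "T' \<subseteq> T" "info G i (T, n) \<subseteq> copies T'"
    using U0 x xTn by blast
  have z: "(T', n) \<in> info G i x" using U1 T' x xTn by blast
  have zact: "(T', n) \<in> active_copies G (Some i)" using info_self[OF x z] by blast
  have fin: "finite (own_preds G i (S, k))" if "S \<in> trees G" for S k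
    using trees_tree[OF that] unfolding is_tree_def own_preds_def by simp
  have "card (own_preds G i (T', n)) \<le> card (own_preds G i (T, n))"
    using T' fin[OF T(1)] by (intro card_mono) (auto simp: own_preds_def)
  then have "card (experience G i (T', n)) \<le> card (experience G i (T, n))"
    using card_experience[OF pr] x zact xTn by simp
  moreover have "finite (experience G i (T', n))"
    using fin[OF T'(1)] unfolding experience_def by simp
  ultimately have "experience G i x = experience G i (T', n)"
    using experience_subset[OF pr x z] xTn by (simp add: card_seteq)
  \<comment> \<open>Both nodes are members of the same information set, so
    \<open>experience_subset\<close> applies in both directions; \<open>x\<close> itself may lie
    outside that set.\<close>
  moreover have "experience G i (T', n) = experience G i y"
    using experience_subset[OF pr zact, of y] experience_subset[OF pr, of y "(T', n)"]
      info_self[OF x y] info_self[OF x z] y z by auto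
  ultimately show ?thesis by simp
qed

text \<open>Both experiences equal that of a node in the common information set. Conditioning on the
  experience is therefore well defined at an information set.\<close>

lemma experience_cong:
  assumes "perfect_recall G i" "x \<in> active_copies G (Some i)" "y \<in> active_copies G (Some i)"
    "info G i x = info G i y"
  shows "experience G i x = experience G i y"
proof -
  obtain z where "z \<in> info G i x" using info_nonempty[OF assms(2)] by blast
  then show ?thesis
    using experience_info[OF assms(1,2), of z] experience_info[OF assms(1,3), of z] assms(4) by simp
qed

section \<open>Reaching conditions and the telescoping product\<close>

lemma pure_strat_legal:
  assumes "T' \<in> partial_trees G T" "T \<in> trees G" "s \<in> pure_strats G T j"
    "(T', n) \<in> active_copies G (Some j)"
  shows "s (info G j (T', n)) \<in> acts_in G T' n (Some j)"
proof -
  have "s (info G j (T', n)) \<in> info_acts G j (info G j (T', n))"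
    using info_in_partial[OF assms(1,2,4)] assms(3) unfolding pure_strats_def by auto
  then show ?thesis
    using info_acts_avail[OF assms(4)] unfolding avail_def by auto
qed

lemma prescribed_legal:
  assumes T: "T \<in> trees G" and T': "T' \<in> partial_trees G T"
    and s: "s \<in> pure_strats G T i" and t: "t \<in> opp_profiles G T i"
    and m: "m \<in> T' \<inter> dec G" and k: "k \<in> active G m"
  shows "prescribed G (combine i s t) (T', m) k \<in> acts_in G T' m k"
proof -
  have act: "(T', m) \<in> active_copies G k"
    using m k partial_trees_sub[OF T T']
    unfolding active_copies_def all_copies_def copies_def by auto
  show ?thesis
  proof (cases k)
    case None
    let ?X = "{x \<in> active_copies G None. fst x \<in> partial_trees G T}"
    have "(T', m) \<in> ?X" using act T' None by simp
    moreover have "snd t \<in> nature_strats G T"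
      using t unfolding opp_profiles_def mem_Times_iff by blast
    ultimately have "snd t (T', m) \<in> avail G (T', m) None"
      unfolding nature_strats_def
      using PiE_mem[of "snd t" ?X "\<lambda>x. avail G x None" "(T', m)"] by blast
    then show ?thesis using None unfolding combine_def avail_def by simp
  next
    case (Some j)
    have "fst (combine i s t) j \<in> pure_strats G T j"
    proof (cases "j = i")
      case True
      then show ?thesis using s unfolding combine_def by simp
    next
      case False
      moreover have "j \<in> players G" using active_players[of m] m k Some by auto
      moreover have "fst t \<in> (\<Pi>\<^sub>E j\<in>players G - {i}. pure_strats G T j)"
        using t unfolding opp_profiles_def mem_Times_iff by blast
      ultimately show ?thesis unfolding combine_def using PiE_mem[of "fst t" _ _ j] by simp
    qed
    then show ?thesis using pure_strat_legal[OF T' T] act Some by simp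
  qed
qed

text \<open>Separates the requirement on nature and the other players, which does not involve
  \<open>s\<close>, from the requirement on \<open>s\<close>, which depends only on the experience
  at the node.\<close>

lemma reaches_combine_iff:
  assumes T: "T \<in> trees G" and T': "T' \<in> partial_trees G T"
    and s: "s \<in> pure_strats G T i" and t: "t \<in> opp_profiles G T i" and n: "n \<in> T'"
  shows "reaches G T' (combine i s t) n \<longleftrightarrow>
    (\<forall>m\<in>T'. prec G m n \<longrightarrow>
      (\<forall>k\<in>active G m - {Some i}. prescribed G t (T', m) k = action_towards G T' m n k)) \<and>
    s \<in> consistent (experience G i (T', n))"
    (is "_ \<longleftrightarrow> ?opp \<and> ?own")
proof -
  let ?c = "combine i s t"
  have T'G: "T' \<in> trees G" using partial_trees_sub[OF T T'] .
  have "reaches G T' ?c n \<longleftrightarrow> (\<forall>m\<in>T'. prec G m n \<longrightarrow>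
      (\<forall>k\<in>active G m. prescribed G ?c (T', m) k = action_towards G T' m n k))"
    using reaches_imp_towards[OF T'G prescribed_legal[OF T T' s t]]
      towards_imp_reaches[OF T'G n] by blast
  also have "\<dots> \<longleftrightarrow>
    (\<forall>m\<in>T'. prec G m n \<longrightarrow>
      (\<forall>k\<in>active G m - {Some i}. prescribed G ?c (T', m) k = action_towards G T' m n k)) \<and>
    (\<forall>m\<in>own_preds G i (T', n).
      prescribed G ?c (T', m) (Some i) = action_towards G T' m n (Some i))"
    unfolding own_preds_def by (auto simp del: prescribed.simps)
  also have "\<dots> \<longleftrightarrow> ?opp \<and> ?own"
  proof -
    have "prescribed G ?c x k = prescribed G t x k" if "k \<noteq> Some i" for x k
      using that by (cases k) (auto simp: combine_def)
    moreover have "prescribed G ?c x (Some i) = s (info G i x)" for x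
      by (simp add: combine_def)
    ultimately show ?thesis
      unfolding consistent_def experience_def by auto
  qed
  finally show ?thesis .
qed

text \<open>The node \<open>m\<close> is the last own decision before \<open>n\<close>. As the
  predecessors of \<open>n\<close> form a chain, all other own decisions come before
  \<open>m\<close>.\<close>

lemma experience_last:
  assumes T: "T \<in> trees G" and n: "n \<in> T" and ne: "own_preds G i (T, n) \<noteq> {}"
  obtains m where "m \<in> T" "prec G m n" "(T, m) \<in> active_copies G (Some i)"
    "own_preds G i (T, n) = insert m (own_preds G i (T, m))" "m \<notin> own_preds G i (T, m)"
    "\<And>l. l \<in> own_preds G i (T, m) \<Longrightarrow>
      action_towards G T l n (Some i) = action_towards G T l m (Some i)"
proof -
  note tree = trees_tree[OF T]
  obtain m where m: "m \<in> own_preds G i (T, n)" "\<And>d. d \<in> own_preds G i (T, n) \<Longrightarrow> \<not> prec G m d"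
    using tree_maximal[OF tree, of "own_preds G i (T, n)"] ne unfolding own_preds_def by auto
  have mT: "m \<in> T" "prec G m n" "Some i \<in> active G m" using m(1) unfolding own_preds_def by auto
  have "(T, m) \<in> active_copies G (Some i)"
    using mT T prec_dec[OF T mT(1) n mT(2)]
    unfolding active_copies_def all_copies_def copies_def by auto
  moreover have "own_preds G i (T, n) = insert m (own_preds G i (T, m))"
  proof (intro equalityI subsetI)
    fix l assume l: "l \<in> own_preds G i (T, n)"
    then show "l \<in> insert m (own_preds G i (T, m))"
      using m(2)[OF l] mT tree_preds_total[OF tree n, of l m] unfolding own_preds_def by auto
  next
    fix l assume "l \<in> insert m (own_preds G i (T, m))"
    then show "l \<in> own_preds G i (T, n)"
      using m(1) mT tree_trans[OF tree _ mT(1) n _ mT(2)] unfolding own_preds_def by auto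
  qed
  moreover have "m \<notin> own_preds G i (T, m)"
    using tree_irrefl[OF tree mT(1)] unfolding own_preds_def by simp
  moreover have "action_towards G T l n (Some i) = action_towards G T l m (Some i)"
    if "l \<in> own_preds G i (T, m)" for l
    using that action_towards_mono[OF T _ mT(1) n _ mT(2)] unfolding own_preds_def by auto
  ultimately show ?thesis using that mT by blast
qed

text \<open>The assumption is the chain rule in product form, so that it also makes sense when the
  conditioning event has probability 0. The induction splits off the factor of the last own
  decision.\<close>

lemma prob_consistent_eq_prod:
  assumes T: "T \<in> trees G" and n: "n \<in> T"
    and \<beta>: "\<And>x a. x \<in> active_copies G (Some i) \<Longrightarrow> fst x = T \<Longrightarrow>
      measure_pmf.prob \<sigma> (consistent (experience G i x)) * pmf (\<beta> (info G i x)) a =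
      measure_pmf.prob \<sigma> (consistent (insert (info G i x, a) (experience G i x)))"
  shows "measure_pmf.prob \<sigma> (consistent (experience G i (T, n))) =
    (\<Prod>m\<in>own_preds G i (T, n). pmf (\<beta> (info G i (T, m))) (action_towards G T m n (Some i)))"
  using trees_tree[OF T] n
proof (induction n rule: tree_induct)
  case (less n)
  show ?case
  proof (cases "own_preds G i (T, n) = {}")
    case True
    then have "consistent (experience G i (T, n)) = UNIV"
      unfolding experience_def consistent_def by simp
    with True show ?thesis by simp
  next
    case False
    then obtain m where m: "m \<in> T" "prec G m n" "(T, m) \<in> active_copies G (Some i)"
      and ins: "own_preds G i (T, n) = insert m (own_preds G i (T, m))"
      and notin: "m \<notin> own_preds G i (T, m)"
      and act: "\<And>l. l \<in> own_preds G i (T, m) \<Longrightarrow>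
        action_towards G T l n (Some i) = action_towards G T l m (Some i)"
      using experience_last[OF T less.hyps] by metis
    let ?a = "action_towards G T m n (Some i)"
    have fin: "finite (own_preds G i (T, m))"
      using trees_tree[OF T] unfolding is_tree_def own_preds_def by simp
    \<comment> \<open>Earlier own actions lead to \<open>m\<close> and to \<open>n\<close> alike, so
      only the pair at \<open>m\<close> is new.\<close>
    have "experience G i (T, n) = insert (info G i (T, m), ?a) (experience G i (T, m))"
      unfolding experience_def ins using act by (auto simp: ins)
    then have "measure_pmf.prob \<sigma> (consistent (experience G i (T, n))) =
        measure_pmf.prob \<sigma> (consistent (experience G i (T, m))) * pmf (\<beta> (info G i (T, m))) ?a"
      using \<beta>[OF m(3)] by simp
    also have "\<dots> = (\<Prod>l\<in>own_preds G i (T, n).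
        pmf (\<beta> (info G i (T, l))) (action_towards G T l n (Some i)))"
      using less.IH[OF m(1,2)] act fin notin unfolding ins by (simp add: mult.commute)
    finally show ?thesis .
  qed
qed

end

section \<open>The conditional behavior strategy and its equivalence to
  \<open>\<sigma>\<close>\<close>

lemma prob_times_pmf_map_cond_pmf:
  assumes "set_pmf p \<inter> A \<noteq> {}"
  shows "measure_pmf.prob p A * pmf (map_pmf f (cond_pmf p A)) a =
    measure_pmf.prob p (A \<inter> f -` {a})"
  using assms emeasure_measure_pmf_not_zero[OF assms] measure_measure_pmf_not_zero[OF assms]
  by (simp add: pmf_map cond_pmf.rep_eq measure_pmf.emeasure_eq_measure)

theorem corollary4:
  fixes G :: "('p, 'v, 'a) ef_game" and T :: "'v set" and i :: 'p
  assumes "unawareness_game G"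
    and "T \<in> trees G"
    and "i \<in> players G"
    and "perfect_recall G i"
  shows "\<forall>\<sigma> \<in> mixed_strats G T i. \<exists>\<beta> \<in> behavior_strats G T i. equivalent_strats G T i \<sigma> \<beta>"
proof
  interpret unawareness_game G by fact
  note T = assms(2) and pr = assms(4)
  fix \<sigma> assume "\<sigma> \<in> mixed_strats G T i"
  then have \<sigma>: "set_pmf \<sigma> \<subseteq> pure_strats G T i" unfolding mixed_strats_def by simp
  \<comment> \<open>The event on which \<open>\<sigma>\<close> is conditioned at \<open>H\<close>;
    by \<open>experience_cong\<close> the choice of the representative node is immaterial.\<close>
  define R where
    "R H = consistent (experience G i (SOME x. x \<in> active_copies G (Some i) \<and> info G i x = H))" for H
  have R: "R (info G i x) = consistent (experience G i x)"
    if "x \<in> active_copies G (Some i)" for x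
  proof -
    define y where "y = (SOME y. y \<in> active_copies G (Some i) \<and> info G i y = info G i x)"
    have "y \<in> active_copies G (Some i) \<and> info G i y = info G i x"
      unfolding y_def by (rule someI[of _ x]) (simp add: that)
    then show ?thesis
      using experience_cong[OF pr _ that, of y] unfolding R_def y_def[symmetric] by simp
  qed
  \<comment> \<open>If \<open>\<sigma>\<close> gives the event \<open>R H\<close> no weight, any
    legal action serves as default: both sides of the chain rule are then 0.\<close>
  define \<beta> where "\<beta> = (\<lambda>H\<in>partial_infos G T i.
    if set_pmf \<sigma> \<inter> R H \<noteq> {} then map_pmf (\<lambda>s. s H) (cond_pmf \<sigma> (R H))
    else return_pmf (SOME a. a \<in> info_acts G i H))"
  have "\<beta> \<in> behavior_strats G T i"
    unfolding behavior_strats_def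
  proof (rule PiE_I)
    fix H assume H: "H \<in> partial_infos G T i"
    then have "info_acts G i H \<noteq> {}"
      using info_acts_nonempty unfolding partial_infos_def by auto
    then have "(SOME a. a \<in> info_acts G i H) \<in> info_acts G i H" by (simp add: some_in_eq)
    moreover have "s H \<in> info_acts G i H" if "s \<in> set_pmf \<sigma>" for s
      using \<sigma> that H unfolding pure_strats_def by auto
    ultimately show "\<beta> H \<in> {p. set_pmf p \<subseteq> info_acts G i H}"
      using H unfolding \<beta>_def by (auto simp: set_cond_pmf)
  qed (simp add: \<beta>_def)
  moreover have "equivalent_strats G T i \<sigma> \<beta>"
    unfolding equivalent_strats_def
  proof (intro ballI)
    fix t T' x
    assume t: "t \<in> opp_profiles G T i" and T': "T' \<in> partial_trees G T" and "x \<in> copies T'"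
    then obtain n where x: "x = (T', n)" and n: "n \<in> T'" unfolding copies_def by auto
    have T'G: "T' \<in> trees G" using partial_trees_sub[OF T T'] .
    \<comment> \<open>If nature or another player leaves the path to \<open>n\<close>, no pure
      strategy of \<open>i\<close> reaches \<open>n\<close>, and both probabilities are 0.\<close>
    define off where "off \<longleftrightarrow> (\<exists>m\<in>T'. prec G m n \<and>
      (\<exists>k \<in> active G m - {Some i}. prescribed G t (T', m) k \<noteq> action_towards G T' m n k))"
    have reach: "{s \<in> pure_strats G T i. reaches G T' (combine i s t) n} =
        (if off then {} else pure_strats G T i \<inter> consistent (experience G i (T', n)))"
      using reaches_combine_iff[OF T T' _ t n] unfolding off_def by auto
    have \<beta>_cond: "measure_pmf.prob \<sigma> (consistent (experience G i y)) * pmf (\<beta> (info G i y)) a =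
        measure_pmf.prob \<sigma> (consistent (insert (info G i y, a) (experience G i y)))"
      if y: "y \<in> active_copies G (Some i)" "fst y = T'" for y a
    proof -
      let ?H = "info G i y"
      have H: "?H \<in> partial_infos G T i"
        using info_in_partial[OF T' T, of "snd y"] y by auto
      have ins: "consistent (insert (?H, a) (experience G i y)) = R ?H \<inter> (\<lambda>s. s ?H) -` {a}"
        using R[OF y(1)] unfolding consistent_def by auto
      show ?thesis
      proof (cases "set_pmf \<sigma> \<inter> R ?H = {}")
        case True
        then have "measure_pmf.prob \<sigma> (R ?H) = 0" "measure_pmf.prob \<sigma> (R ?H \<inter> (\<lambda>s. s ?H) -` {a}) = 0"
          by (auto simp: measure_pmf_zero_iff)
        then show ?thesis using ins R[OF y(1)] by simp
      next
        case False
        then show ?thesis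
          using prob_times_pmf_map_cond_pmf[OF False, of "\<lambda>s. s ?H" a] ins R[OF y(1)] H
          unfolding \<beta>_def by simp
      qed
    qed
    \<comment> \<open>The support of \<open>\<sigma>\<close> consists of legal pure strategies, so
      intersecting with them does not change the probability.\<close>
    have "measure_pmf.prob \<sigma> (pure_strats G T i \<inter> consistent (experience G i (T', n))) =
        measure_pmf.prob \<sigma> (consistent (experience G i (T', n)))"
      using \<sigma> by (intro measure_pmf.finite_measure_eq_AE) (auto simp: AE_measure_pmf_iff)
    also have "\<dots> = (\<Prod>m\<in>own_preds G i (T', n).
        pmf (\<beta> (info G i (T', m))) (action_towards G T' m n (Some i)))"
      using prob_consistent_eq_prod[OF T'G n \<beta>_cond] .
    finally show "rho_mixed G T i x \<sigma> t = rho_behavior G i x \<beta> t"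
      unfolding rho_mixed_def rho_behavior_def x Let_def fst_conv snd_conv reach
        off_def[symmetric] own_preds_def
      by simp
  qed
  ultimately show "\<exists>\<beta>\<in>behavior_strats G T i. equivalent_strats G T i \<sigma> \<beta>" by blast
qed

end
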